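(* Let $\mathscr{C}$ be an extriangulated category with negative first extensions. Then the assignments $$(\mathcal{T},\mathcal{F})\mapsto(\mathrm{Defl}\,\mathcal{T},\mathrm{Defl}\,\mathcal{F})\quad\text{and}\quad(\mathcal{L},\mathcal{R})\mapsto(\mathrm{Cocone}(\mathcal{L}),\mathrm{Cocone}(\mathcal{R}))$$ give mutually inverse bijections between the following classes: (1) $s$-torsion pairs in $\mathscr{C}$; (2) deflation factorization systems in $\mathscr{C}$.
   Context: All categories are additive; all subcategories are full and closed under isomorphisms. Extriangulated category (Nakaoka–Palu): a triple $(\mathscr{C},\mathbb{E},\mathfrak{s})$ where $\mathscr{C}$ is an additive category, (ET1) $\mathbb{E}:\mathscr{C}^{op}\times\mathscr{C}\to Ab$ is a biadditive functor, and (ET2) $\mathfrak{s}$ is an additive realization of $\mathbb{E}$. For $\delta\in\mathbb{E}(C,A)$, $a:A\to A'$, $c:C'\to C$ write $a_*\delta=\mathbb{E}(C,a)(\delta)$, $c^*\delta=\mathbb{E}(c,A)(\delta)$. A morphism $(a,c):\delta\to\delta'$ from $\delta\in\mathbb{E}(C,A)$ to $\delta'\in\mathbb{E}(C',A')$ is a pair $a:A\to A'$, $c:C\to C'$ with $a_*\delta=c^*\delta'$. A realization $\mathfrak{s}$ assigns to each $\delta\in\mathbb{E}(C,A)$ an equivalence class $[A\xrightarrow{x}B\xrightarrow{y}C]$ (two such sequences are equivalent if there is an isomorphism of middle terms compatible with the identities of $A$ and $C$), such that each morphism $(a,c):\delta\to\delta'$ can be completed by some $b:B\to B'$ to a commutative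 diagram between the realizing sequences; it is additive if $\mathfrak{s}(0)=[A\to A\oplus C\to C]$ (the canonical split sequence) and $\mathfrak{s}(\delta\oplus\delta')=\mathfrak{s}(\delta)\oplus\mathfrak{s}(\delta')$. Moreover: (ET3) if $\mathfrak{s}(\delta)=[A\xrightarrow{x}B\xrightarrow{y}C]$, $\mathfrak{s}(\delta')=[A'\xrightarrow{x'}B'\xrightarrow{y'}C']$ and $bx=x'a$, there is $c:C\to C'$ with $cy=y'b$ and $a_*\delta=c^*\delta'$; (ET4) if $\mathfrak{s}(\delta)=[A\xrightarrow{f}B\xrightarrow{f'}D]$ and $\mathfrak{s}(\delta')=[B\xrightarrow{g}C\xrightarrow{g'}F]$, there are an object $E$, morphisms $h':C\to E$, $d:D\to E$, $e:E\to F$ and $\delta''\in\mathbb{E}(E,A)$ with $h'g=df'$, $eh'=g'$, $\mathfrak{s}(\delta'')=[A\xrightarrow{gf}C\xrightarrow{h'}E]$, $\mathfrak{s}(f'_*\delta')=[D\xrightarrow{d}E\xrightarrow{e}F]$, $d^*\delta''=\delta$, $f_*\delta''=e^*\delta'$; and the duals (ET3)$^{op}$, (ET4)$^{op}$. If $\mathfrak{s}(\delta)=[A\xrightarrow{x}B\xrightarrow{y}C]$, then $A\xrightarrow{x}B\xrightarrow{y}C$ is a conflation, $x$ an inflation, $y$ a deflation, and $A\xrightarrow{x}B\xrightarrow{y}C\overset{\delta}{\dashrightarrow}$ an $\mathbb{E}$-triangle; one writes $C=\mathrm{cone}(x)$, $A=\mathrm{cocone}(y)$ (unique up to isomorphism).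 Negative first extensions: $\mathscr{C}$ has a negative first extension structure if it is equipped with an additive bifunctor $\mathbb{E}^{-1}:\mathscr{C}^{op}\times\mathscr{C}\to Ab$ and, for each $\delta\in\mathbb{E}(C,A)$, natural transformations $\delta^{-1}_\sharp:\mathbb{E}^{-1}(-,C)\to\mathscr{C}(-,A)$ and $\delta_{-1}^\sharp:\mathbb{E}^{-1}(A,-)\to\mathscr{C}(C,-)$ such that for each $\mathbb{E}$-triangle $A\xrightarrow{f}B\xrightarrow{g}C\overset{\delta}{\dashrightarrow}$ and each $W\in\mathscr{C}$ the sequences $$\mathbb{E}^{-1}(W,A)\to\mathbb{E}^{-1}(W,B)\to\mathbb{E}^{-1}(W,C)\xrightarrow{(\delta^{-1}_\sharp)_W}\mathscr{C}(W,A)\to\mathscr{C}(W,B),$$ $$\mathbb{E}^{-1}(C,W)\to\mathbb{E}^{-1}(B,W)\to\mathbb{E}^{-1}(A,W)\xrightarrow{(\delta_{-1}^\sharp)_W}\mathscr{C}(C,W)\to\mathscr{C}(B,W)$$ (unlabelled maps induced by $f$ and $g$) are exact. $s$-torsion pair: a pair $(\mathcal{T},\mathcal{F})$ of subcategories of $\mathscr{C}$ such that (1) $\mathscr{C}=\mathcal{T}*\mathcal{F}$, i.e. every $X\in\mathscr{C}$ admits an $\mathbb{E}$-triangle $T\to X\to F\dashrightarrow$ with $T\in\mathcal{T}$, $F\in\mathcal{F}$; (2) $\mathscr{C}(\mathcal{T},\mathcal{F})=0$; (3) $\mathbb{E}^{-1}(\mathcal{T},\mathcal{F})=0$. Deflation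 factorization system: for deflations $l,r$ write $l\perp r$ if $\mathscr{C}(\mathrm{cocone}(l),\mathrm{cocone}(r))=0$ and $\mathbb{E}^{-1}(\mathrm{cocone}(l),\mathrm{cocone}(r))=0$. For a class $\mathcal{J}$ of deflations, $\mathcal{J}^\perp=\{f\text{ deflation}\mid g\perp f\ \forall g\in\mathcal{J}\}$ and ${}^\perp\mathcal{J}=\{f\text{ deflation}\mid f\perp g\ \forall g\in\mathcal{J}\}$. A pair $(\mathcal{L},\mathcal{R})$ of classes of deflations is a deflation factorization system if (1) each deflation $f$ has a factorization $f=rl$ with $l\in\mathcal{L}$, $r\in\mathcal{R}$; (2) $\mathcal{L}={}^\perp\mathcal{R}$; (3) $\mathcal{L}^\perp=\mathcal{R}$. For a subcategory $\mathcal{U}$, $\mathrm{Defl}\,\mathcal{U}=\{f\text{ a deflation}\mid\mathrm{cocone}(f)\in\mathcal{U}\}$. For a class $\mathcal{J}$ of deflations, $\mathrm{Cocone}(\mathcal{J})=\{U\in\mathscr{C}\mid U\cong\mathrm{cocone}(f)\text{ for some }f\in\mathcal{J}\}$. *)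

theory Defs
  imports "HOL-Algebra.Coset"
begin

section \<open>Additive categories\<close>

text \<open>
  Abelian groups are HOL-Algebra's commutative groups, hence written multiplicatively: on morphisms
  and extensions, \<open>\<otimes>\<close> is the sum and \<open>\<one>\<close> is zero.  Composition of morphisms is the separate
  operation \<open>\<cdot>\<close>, in the usual order (\<open>g \<cdot> f\<close> is ``first \<open>f\<close>'').
  Distinct Hom-sets are disjoint, so a class of morphisms is a plain set of arrows.
\<close>

record ('o, 'm) cat =
  obj :: "'o set"
  Hom :: "'o \<Rightarrow> 'o \<Rightarrow> 'm monoid"
  cmp :: "'m \<Rightarrow> 'm \<Rightarrow> 'm"  (infixr \<open>\<cdot>\<index>\<close> 75)
  idm :: "'o \<Rightarrow> 'm"

definition is_iso :: "('o, 'm, 'z) cat_scheme \<Rightarrow> 'o \<Rightarrow> 'o \<Rightarrow> 'm \<Rightarrow> bool" where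
  "is_iso \<C> A B f \<longleftrightarrow> f \<in> carrier (Hom \<C> A B) \<and>
     (\<exists>g \<in> carrier (Hom \<C> B A). g \<cdot>\<^bsub>\<C>\<^esub> f = idm \<C> A \<and> f \<cdot>\<^bsub>\<C>\<^esub> g = idm \<C> B)"

definition isomorphic :: "('o, 'm, 'z) cat_scheme \<Rightarrow> 'o \<Rightarrow> 'o \<Rightarrow> bool" where
  "isomorphic \<C> A B \<longleftrightarrow> A \<in> obj \<C> \<and> B \<in> obj \<C> \<and> (\<exists>f. is_iso \<C> A B f)"

definition zero_object :: "('o, 'm, 'z) cat_scheme \<Rightarrow> 'o \<Rightarrow> bool" where
  "zero_object \<C> Z \<longleftrightarrow> Z \<in> obj \<C> \<and>
     (\<forall>A \<in> obj \<C>. (\<exists>!f. f \<in> carrier (Hom \<C> A Z)) \<and> (\<exists>!f. f \<in> carrier (Hom \<C> Z A)))"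

text \<open>\<open>P = A \<oplus> B\<close> with injections \<open>i\<close>, \<open>j\<close> and projections \<open>p\<close>, \<open>q\<close>.\<close>

definition biproduct ::
  "('o, 'm, 'z) cat_scheme \<Rightarrow> 'o \<Rightarrow> 'o \<Rightarrow> 'o \<Rightarrow> 'm \<Rightarrow> 'm \<Rightarrow> 'm \<Rightarrow> 'm \<Rightarrow> bool" where
  "biproduct \<C> A B P i j p q \<longleftrightarrow>
     A \<in> obj \<C> \<and> B \<in> obj \<C> \<and> P \<in> obj \<C> \<and>
     i \<in> carrier (Hom \<C> A P) \<and> j \<in> carrier (Hom \<C> B P) \<and>
     p \<in> carrier (Hom \<C> P A) \<and> q \<in> carrier (Hom \<C> P B) \<and>
     p \<cdot>\<^bsub>\<C>\<^esub> i = idm \<C> A \<and> q \<cdot>\<^bsub>\<C>\<^esub> j = idm \<C> B \<and>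
     p \<cdot>\<^bsub>\<C>\<^esub> j = \<one>\<^bsub>Hom \<C> B A\<^esub> \<and> q \<cdot>\<^bsub>\<C>\<^esub> i = \<one>\<^bsub>Hom \<C> A B\<^esub> \<and>
     (i \<cdot>\<^bsub>\<C>\<^esub> p) \<otimes>\<^bsub>Hom \<C> P P\<^esub> (j \<cdot>\<^bsub>\<C>\<^esub> q) = idm \<C> P"

locale additive_category =
  fixes \<C> :: "('o, 'm, 'z) cat_scheme" (structure)
  assumes hom_disjoint:
      "\<lbrakk>A \<in> obj \<C>; B \<in> obj \<C>; A' \<in> obj \<C>; B' \<in> obj \<C>;
        f \<in> carrier (Hom \<C> A B); f \<in> carrier (Hom \<C> A' B')\<rbrakk> \<Longrightarrow> A = A' \<and> B = B'"
    and hom_comm_group: "\<lbrakk>A \<in> obj \<C>; B \<in> obj \<C>\<rbrakk> \<Longrightarrow> comm_group (Hom \<C> A B)"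
    and idm_closed: "A \<in> obj \<C> \<Longrightarrow> idm \<C> A \<in> carrier (Hom \<C> A A)"
    and cmp_closed:
      "\<lbrakk>A \<in> obj \<C>; B \<in> obj \<C>; C \<in> obj \<C>; f \<in> carrier (Hom \<C> A B); g \<in> carrier (Hom \<C> B C)\<rbrakk>
       \<Longrightarrow> g \<cdot> f \<in> carrier (Hom \<C> A C)"
    and cmp_idm:
      "\<lbrakk>A \<in> obj \<C>; B \<in> obj \<C>; f \<in> carrier (Hom \<C> A B)\<rbrakk> \<Longrightarrow> f \<cdot> idm \<C> A = f"
    and idm_cmp:
      "\<lbrakk>A \<in> obj \<C>; B \<in> obj \<C>; f \<in> carrier (Hom \<C> A B)\<rbrakk> \<Longrightarrow> idm \<C> B \<cdot> f = f"
    and cmp_assoc: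
      "\<lbrakk>A \<in> obj \<C>; B \<in> obj \<C>; C \<in> obj \<C>; D \<in> obj \<C>; f \<in> carrier (Hom \<C> A B);
        g \<in> carrier (Hom \<C> B C); h \<in> carrier (Hom \<C> C D)\<rbrakk> \<Longrightarrow> (h \<cdot> g) \<cdot> f = h \<cdot> (g \<cdot> f)"
    and cmp_add_right:
      "\<lbrakk>A \<in> obj \<C>; B \<in> obj \<C>; C \<in> obj \<C>; f \<in> carrier (Hom \<C> A B); f' \<in> carrier (Hom \<C> A B);
        g \<in> carrier (Hom \<C> B C)\<rbrakk>
       \<Longrightarrow> g \<cdot> (f \<otimes>\<^bsub>Hom \<C> A B\<^esub> f') = (g \<cdot> f) \<otimes>\<^bsub>Hom \<C> A C\<^esub> (g \<cdot> f')"
    and cmp_add_left: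
      "\<lbrakk>A \<in> obj \<C>; B \<in> obj \<C>; C \<in> obj \<C>; f \<in> carrier (Hom \<C> A B); g \<in> carrier (Hom \<C> B C);
        g' \<in> carrier (Hom \<C> B C)\<rbrakk>
       \<Longrightarrow> (g \<otimes>\<^bsub>Hom \<C> B C\<^esub> g') \<cdot> f = (g \<cdot> f) \<otimes>\<^bsub>Hom \<C> A C\<^esub> (g' \<cdot> f)"
    and zero_object_exists: "\<exists>Z. zero_object \<C> Z"
    and biproduct_exists:
      "\<lbrakk>A \<in> obj \<C>; B \<in> obj \<C>\<rbrakk> \<Longrightarrow> \<exists>P i j p q. biproduct \<C> A B P i j p q"

text \<open>
  A biadditive functor \<open>F : \<C>\<^sup>o\<^sup>p \<times> \<C> \<rightarrow> Ab\<close>: \<open>F C A\<close> is the value at \<open>(C, A)\<close>, and for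
  \<open>c : C' \<rightarrow> C\<close>, \<open>a : A \<rightarrow> A'\<close> the induced map \<open>F C A \<rightarrow> F C' A'\<close> is \<open>Fm c a\<close>.
\<close>

locale additive_bifunctor = additive_category \<C>
  for \<C> :: "('o, 'm, 'z) cat_scheme" (structure) +
  fixes F :: "'o \<Rightarrow> 'o \<Rightarrow> 'e monoid" and Fm :: "'m \<Rightarrow> 'm \<Rightarrow> 'e \<Rightarrow> 'e"
  assumes bif_comm_group: "\<lbrakk>C \<in> obj \<C>; A \<in> obj \<C>\<rbrakk> \<Longrightarrow> comm_group (F C A)"
    and bif_hom:
      "\<lbrakk>C \<in> obj \<C>; C' \<in> obj \<C>; A \<in> obj \<C>; A' \<in> obj \<C>;
        c \<in> carrier (Hom \<C> C' C); a \<in> carrier (Hom \<C> A A')\<rbrakk> \<Longrightarrow> Fm c a \<in> hom (F C A) (F C' A')"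
    and bif_idm:
      "\<lbrakk>C \<in> obj \<C>; A \<in> obj \<C>; \<delta> \<in> carrier (F C A)\<rbrakk> \<Longrightarrow> Fm (idm \<C> C) (idm \<C> A) \<delta> = \<delta>"
    and bif_cmp:
      "\<lbrakk>C \<in> obj \<C>; C' \<in> obj \<C>; C'' \<in> obj \<C>; A \<in> obj \<C>; A' \<in> obj \<C>; A'' \<in> obj \<C>;
        c \<in> carrier (Hom \<C> C' C); c' \<in> carrier (Hom \<C> C'' C');
        a \<in> carrier (Hom \<C> A A'); a' \<in> carrier (Hom \<C> A' A''); \<delta> \<in> carrier (F C A)\<rbrakk>
       \<Longrightarrow> Fm (c \<cdot> c') (a' \<cdot> a) \<delta> = Fm c' a' (Fm c a \<delta>)"
    and bif_add_right:
      "\<lbrakk>C \<in> obj \<C>; A \<in> obj \<C>; A' \<in> obj \<C>;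
        a \<in> carrier (Hom \<C> A A'); a' \<in> carrier (Hom \<C> A A'); \<delta> \<in> carrier (F C A)\<rbrakk>
       \<Longrightarrow> Fm (idm \<C> C) (a \<otimes>\<^bsub>Hom \<C> A A'\<^esub> a') \<delta>
         = Fm (idm \<C> C) a \<delta> \<otimes>\<^bsub>F C A'\<^esub> Fm (idm \<C> C) a' \<delta>"
    and bif_add_left:
      "\<lbrakk>C \<in> obj \<C>; C' \<in> obj \<C>; A \<in> obj \<C>;
        c \<in> carrier (Hom \<C> C' C); c' \<in> carrier (Hom \<C> C' C); \<delta> \<in> carrier (F C A)\<rbrakk>
       \<Longrightarrow> Fm (c \<otimes>\<^bsub>Hom \<C> C' C\<^esub> c') (idm \<C> A) \<delta>
         = Fm c (idm \<C> A) \<delta> \<otimes>\<^bsub>F C' A\<^esub> Fm c' (idm \<C> A) \<delta>"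


section \<open>Extriangulated categories\<close>

text \<open>
  \<open>Ext C A\<close> is \<open>\<E>(C, A)\<close>.  The realization of \<open>\<delta> \<in> \<E>(C, A)\<close> is \<open>realize C A \<delta>\<close>, an equivalence
  class of sequences \<open>A \<rightarrow> B \<rightarrow> C\<close>; a sequence is encoded by its pair of morphisms.
\<close>

record ('o, 'm, 'e) ext_cat = "('o, 'm) cat" +
  Ext :: "'o \<Rightarrow> 'o \<Rightarrow> 'e monoid"
  Ext_map :: "'m \<Rightarrow> 'm \<Rightarrow> 'e \<Rightarrow> 'e"
  realize :: "'o \<Rightarrow> 'o \<Rightarrow> 'e \<Rightarrow> ('m \<times> 'm) set"

text \<open>For \<open>\<delta> \<in> \<E>(C, A)\<close>: \<open>push \<C> C a \<delta>\<close> is \<open>a\<^sub>* \<delta>\<close>, and \<open>pull \<C> A c \<delta>\<close> is \<open>c\<^sup>* \<delta>\<close>.\<close>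

definition push :: "('o, 'm, 'e, 'z) ext_cat_scheme \<Rightarrow> 'o \<Rightarrow> 'm \<Rightarrow> 'e \<Rightarrow> 'e" where
  "push \<C> C a \<delta> = Ext_map \<C> (idm \<C> C) a \<delta>"

definition pull :: "('o, 'm, 'e, 'z) ext_cat_scheme \<Rightarrow> 'o \<Rightarrow> 'm \<Rightarrow> 'e \<Rightarrow> 'e" where
  "pull \<C> A c \<delta> = Ext_map \<C> c (idm \<C> A) \<delta>"

definition seqs :: "('o, 'm, 'z) cat_scheme \<Rightarrow> 'o \<Rightarrow> 'o \<Rightarrow> ('m \<times> 'm) set" where
  "seqs \<C> A C = {(x, y). \<exists>B \<in> obj \<C>. x \<in> carrier (Hom \<C> A B) \<and> y \<in> carrier (Hom \<C> B C)}"

definition seq_equiv ::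
  "('o, 'm, 'z) cat_scheme \<Rightarrow> 'o \<Rightarrow> 'o \<Rightarrow> (('m \<times> 'm) \<times> ('m \<times> 'm)) set" where
  "seq_equiv \<C> A C = {((x, y), (x', y')). \<exists>B \<in> obj \<C>. \<exists>B' \<in> obj \<C>. \<exists>b.
     x \<in> carrier (Hom \<C> A B) \<and> y \<in> carrier (Hom \<C> B C) \<and>
     x' \<in> carrier (Hom \<C> A B') \<and> y' \<in> carrier (Hom \<C> B' C) \<and>
     is_iso \<C> B B' b \<and> b \<cdot>\<^bsub>\<C>\<^esub> x = x' \<and> y' \<cdot>\<^bsub>\<C>\<^esub> b = y}"

definition seq_class :: "('o, 'm, 'z) cat_scheme \<Rightarrow> 'o \<Rightarrow> 'o \<Rightarrow> 'm \<Rightarrow> 'm \<Rightarrow> ('m \<times> 'm) set" where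
  "seq_class \<C> A C x y = seq_equiv \<C> A C `` {(x, y)}"

text \<open>The \<open>\<E>\<close>-triangle \<open>A \<rightarrow> B \<rightarrow> C\<close> with morphisms \<open>x\<close>, \<open>y\<close> realizing \<open>\<delta>\<close>.\<close>

definition E_triangle ::
  "('o, 'm, 'e, 'z) ext_cat_scheme \<Rightarrow> 'o \<Rightarrow> 'm \<Rightarrow> 'o \<Rightarrow> 'm \<Rightarrow> 'o \<Rightarrow> 'e \<Rightarrow> bool" where
  "E_triangle \<C> A x B y C \<delta> \<longleftrightarrow>
     A \<in> obj \<C> \<and> B \<in> obj \<C> \<and> C \<in> obj \<C> \<and>
     x \<in> carrier (Hom \<C> A B) \<and> y \<in> carrier (Hom \<C> B C) \<and> \<delta> \<in> carrier (Ext \<C> C A) \<and>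
     realize \<C> C A \<delta> = seq_class \<C> A C x y"

text \<open>
  The axiom \<open>realize_sum\<close>: under the biadditivity isomorphism, the element of
  \<open>\<E>(C \<oplus> C', A \<oplus> A')\<close> corresponding to \<open>(\<delta>, 0, 0, \<delta>')\<close> is the sum of the images of \<open>\<delta>\<close> and \<open>\<delta>'\<close>
  along the projections of \<open>C \<oplus> C'\<close> and the injections of \<open>A \<oplus> A'\<close>.  In both additivity axioms the
  biproducts are arbitrary; they are unique up to isomorphism.
\<close>

locale extriangulated_category =
  additive_bifunctor \<C> "Ext \<C>" "Ext_map \<C>"
  for \<C> :: "('o, 'm, 'e, 'z) ext_cat_scheme" (structure) +
  assumes realize_class:
      "\<lbrakk>A \<in> obj \<C>; C \<in> obj \<C>; \<delta> \<in> carrier (Ext \<C> C A)\<rbrakk>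
       \<Longrightarrow> realize \<C> C A \<delta> \<in> seqs \<C> A C // seq_equiv \<C> A C"
    and realize_morphism:
      "\<lbrakk>E_triangle \<C> A x B y C \<delta>; E_triangle \<C> A' x' B' y' C' \<delta>';
        a \<in> carrier (Hom \<C> A A'); c \<in> carrier (Hom \<C> C C'); push \<C> C a \<delta> = pull \<C> A' c \<delta>'\<rbrakk>
       \<Longrightarrow> \<exists>b \<in> carrier (Hom \<C> B B'). b \<cdot> x = x' \<cdot> a \<and> y' \<cdot> b = c \<cdot> y"
    and realize_zero:
      "biproduct \<C> A C P i j p q \<Longrightarrow> realize \<C> C A \<one>\<^bsub>Ext \<C> C A\<^esub> = seq_class \<C> A C i q"
    and realize_sum:
      "\<lbrakk>E_triangle \<C> A x B y C \<delta>; E_triangle \<C> A' x' B' y' C' \<delta>';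
        biproduct \<C> A A' PA iA jA pA qA;
        biproduct \<C> B B' PB iB jB pB qB;
        biproduct \<C> C C' PC iC jC pC qC\<rbrakk>
       \<Longrightarrow> realize \<C> PC PA (Ext_map \<C> pC iA \<delta> \<otimes>\<^bsub>Ext \<C> PC PA\<^esub> Ext_map \<C> qC jA \<delta>')
         = seq_class \<C> PA PC
             ((iB \<cdot> x \<cdot> pA) \<otimes>\<^bsub>Hom \<C> PA PB\<^esub> (jB \<cdot> x' \<cdot> qA))
             ((iC \<cdot> y \<cdot> pB) \<otimes>\<^bsub>Hom \<C> PB PC\<^esub> (jC \<cdot> y' \<cdot> qB))"
    and ET3:
      "\<lbrakk>E_triangle \<C> A x B y C \<delta>; E_triangle \<C> A' x' B' y' C' \<delta>';
        a \<in> carrier (Hom \<C> A A'); b \<in> carrier (Hom \<C> B B'); b \<cdot> x = x' \<cdot> a\<rbrakk>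
       \<Longrightarrow> \<exists>c \<in> carrier (Hom \<C> C C'). c \<cdot> y = y' \<cdot> b \<and> push \<C> C a \<delta> = pull \<C> A' c \<delta>'"
    and ET3_op:
      "\<lbrakk>E_triangle \<C> A x B y C \<delta>; E_triangle \<C> A' x' B' y' C' \<delta>';
        b \<in> carrier (Hom \<C> B B'); c \<in> carrier (Hom \<C> C C'); c \<cdot> y = y' \<cdot> b\<rbrakk>
       \<Longrightarrow> \<exists>a \<in> carrier (Hom \<C> A A'). b \<cdot> x = x' \<cdot> a \<and> push \<C> C a \<delta> = pull \<C> A' c \<delta>'"
    and ET4:
      "\<lbrakk>E_triangle \<C> A f B f' D \<delta>; E_triangle \<C> B g C g' F \<delta>'\<rbrakk>
       \<Longrightarrow> \<exists>E h' d e \<delta>''.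
             E_triangle \<C> A (g \<cdot> f) C h' E \<delta>'' \<and>
             E_triangle \<C> D d E e F (push \<C> F f' \<delta>') \<and>
             h' \<cdot> g = d \<cdot> f' \<and> e \<cdot> h' = g' \<and>
             pull \<C> A d \<delta>'' = \<delta> \<and> push \<C> E f \<delta>'' = pull \<C> B e \<delta>'"
    and ET4_op:
      "\<lbrakk>E_triangle \<C> D f' B f A \<delta>; E_triangle \<C> F g' C g B \<delta>'\<rbrakk>
       \<Longrightarrow> \<exists>E h' d e \<delta>''.
             E_triangle \<C> E h' C (f \<cdot> g) A \<delta>'' \<and>
             E_triangle \<C> F e E d D (pull \<C> F f' \<delta>') \<and>
             g \<cdot> h' = f' \<cdot> d \<and> h' \<cdot> e = g' \<and>
             push \<C> A d \<delta>'' = \<delta> \<and> pull \<C> E f \<delta>'' = push \<C> B e \<delta>'"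


section \<open>Negative first extensions\<close>

text \<open>
  \<open>NExt\<close> is \<open>\<E>\<^sup>-\<^sup>1\<close>.  For \<open>\<delta> \<in> \<E>(C, A)\<close> and an object \<open>W\<close>, \<open>sharp_cov C A \<delta> W\<close> is the map
  \<open>\<E>\<^sup>-\<^sup>1(W, C) \<rightarrow> \<C>(W, A)\<close> (the \<open>W\<close>-component of the transformation with lower \<open>\<sharp>\<close>), and
  \<open>sharp_con C A \<delta> W\<close> is the map \<open>\<E>\<^sup>-\<^sup>1(A, W) \<rightarrow> \<C>(C, W)\<close> (upper \<open>\<sharp>\<close>).
\<close>

record ('o, 'm, 'e, 'n) neg_ext_cat = "('o, 'm, 'e) ext_cat" +
  NExt :: "'o \<Rightarrow> 'o \<Rightarrow> 'n monoid"
  NExt_map :: "'m \<Rightarrow> 'm \<Rightarrow> 'n \<Rightarrow> 'n"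
  sharp_cov :: "'o \<Rightarrow> 'o \<Rightarrow> 'e \<Rightarrow> 'o \<Rightarrow> 'n \<Rightarrow> 'm"
  sharp_con :: "'o \<Rightarrow> 'o \<Rightarrow> 'e \<Rightarrow> 'o \<Rightarrow> 'n \<Rightarrow> 'm"

text \<open>
  Exactness of \<open>G \<rightarrow> H \<rightarrow> K\<close> at \<open>H\<close>; unlike \<open>exact_seq\<close> of HOL-Algebra, this allows the groups to
  have elements of different types.
\<close>

definition exact_at ::
  "('a, 'x) monoid_scheme \<Rightarrow> ('a \<Rightarrow> 'b) \<Rightarrow> ('b, 'y) monoid_scheme \<Rightarrow> ('b \<Rightarrow> 'c) \<Rightarrow>
   ('c, 'w) monoid_scheme \<Rightarrow> bool" where
  "exact_at G f H g K \<longleftrightarrow> f ` carrier G = kernel H K g"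

locale neg_extriangulated_category =
  extriangulated_category \<C> + N: additive_bifunctor \<C> "NExt \<C>" "NExt_map \<C>"
  for \<C> :: "('o, 'm, 'e, 'n, 'z) neg_ext_cat_scheme" (structure) +
  assumes sharp_cov_hom:
      "\<lbrakk>C \<in> obj \<C>; A \<in> obj \<C>; \<delta> \<in> carrier (Ext \<C> C A); W \<in> obj \<C>\<rbrakk>
       \<Longrightarrow> sharp_cov \<C> C A \<delta> W \<in> hom (NExt \<C> W C) (Hom \<C> W A)"
    and sharp_cov_natural:
      "\<lbrakk>C \<in> obj \<C>; A \<in> obj \<C>; \<delta> \<in> carrier (Ext \<C> C A); W \<in> obj \<C>; W' \<in> obj \<C>;
        w \<in> carrier (Hom \<C> W' W); \<eta> \<in> carrier (NExt \<C> W C)\<rbrakk>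
       \<Longrightarrow> sharp_cov \<C> C A \<delta> W' (NExt_map \<C> w (idm \<C> C) \<eta>) = sharp_cov \<C> C A \<delta> W \<eta> \<cdot> w"
    and sharp_con_hom:
      "\<lbrakk>C \<in> obj \<C>; A \<in> obj \<C>; \<delta> \<in> carrier (Ext \<C> C A); W \<in> obj \<C>\<rbrakk>
       \<Longrightarrow> sharp_con \<C> C A \<delta> W \<in> hom (NExt \<C> A W) (Hom \<C> C W)"
    and sharp_con_natural:
      "\<lbrakk>C \<in> obj \<C>; A \<in> obj \<C>; \<delta> \<in> carrier (Ext \<C> C A); W \<in> obj \<C>; W' \<in> obj \<C>;
        w \<in> carrier (Hom \<C> W W'); \<eta> \<in> carrier (NExt \<C> A W)\<rbrakk>
       \<Longrightarrow> sharp_con \<C> C A \<delta> W' (NExt_map \<C> (idm \<C> A) w \<eta>) = w \<cdot> sharp_con \<C> C A \<delta> W \<eta>"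
    and exact_cov:
      "\<lbrakk>E_triangle \<C> A f B g C \<delta>; W \<in> obj \<C>\<rbrakk>
       \<Longrightarrow> exact_at (NExt \<C> W A) (NExt_map \<C> (idm \<C> W) f)
                    (NExt \<C> W B) (NExt_map \<C> (idm \<C> W) g) (NExt \<C> W C) \<and>
           exact_at (NExt \<C> W B) (NExt_map \<C> (idm \<C> W) g)
                    (NExt \<C> W C) (sharp_cov \<C> C A \<delta> W) (Hom \<C> W A) \<and>
           exact_at (NExt \<C> W C) (sharp_cov \<C> C A \<delta> W)
                    (Hom \<C> W A) (\<lambda>u. f \<cdot> u) (Hom \<C> W B)"
    and exact_con:
      "\<lbrakk>E_triangle \<C> A f B g C \<delta>; W \<in> obj \<C>\<rbrakk>
       \<Longrightarrow> exact_at (NExt \<C> C W) (NExt_map \<C> g (idm \<C> W))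
                    (NExt \<C> B W) (NExt_map \<C> f (idm \<C> W)) (NExt \<C> A W) \<and>
           exact_at (NExt \<C> B W) (NExt_map \<C> f (idm \<C> W))
                    (NExt \<C> A W) (sharp_con \<C> C A \<delta> W) (Hom \<C> C W) \<and>
           exact_at (NExt \<C> A W) (sharp_con \<C> C A \<delta> W)
                    (Hom \<C> C W) (\<lambda>u. u \<cdot> g) (Hom \<C> B W)"


section \<open>Torsion pairs and deflation factorization systems\<close>

text \<open>Full subcategories closed under isomorphisms, given by their objects.\<close>

definition subcategory :: "('o, 'm, 'z) cat_scheme \<Rightarrow> 'o set \<Rightarrow> bool" where
  "subcategory \<C> \<U> \<longleftrightarrow> \<U> \<subseteq> obj \<C> \<and> (\<forall>A \<in> \<U>. \<forall>B. isomorphic \<C> A B \<longrightarrow> B \<in> \<U>)"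

definition s_torsion_pairs :: "('o, 'm, 'e, 'n, 'z) neg_ext_cat_scheme \<Rightarrow> ('o set \<times> 'o set) set" where
  "s_torsion_pairs \<C> = {(\<T>, \<F>). subcategory \<C> \<T> \<and> subcategory \<C> \<F> \<and>
     (\<forall>X \<in> obj \<C>. \<exists>T \<in> \<T>. \<exists>F \<in> \<F>. \<exists>f g \<delta>. E_triangle \<C> T f X g F \<delta>) \<and>
     (\<forall>T \<in> \<T>. \<forall>F \<in> \<F>. carrier (Hom \<C> T F) = {\<one>\<^bsub>Hom \<C> T F\<^esub>}) \<and>
     (\<forall>T \<in> \<T>. \<forall>F \<in> \<F>. carrier (NExt \<C> T F) = {\<one>\<^bsub>NExt \<C> T F\<^esub>})}"

definition deflations :: "('o, 'm, 'e, 'z) ext_cat_scheme \<Rightarrow> 'm set" where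
  "deflations \<C> = {y. \<exists>A x B C \<delta>. E_triangle \<C> A x B y C \<delta>}"

text \<open>A choice of \<open>cocone y\<close>, which is determined up to isomorphism for a deflation \<open>y\<close>.\<close>

definition cocone :: "('o, 'm, 'e, 'z) ext_cat_scheme \<Rightarrow> 'm \<Rightarrow> 'o" where
  "cocone \<C> y = (SOME A. \<exists>x B C \<delta>. E_triangle \<C> A x B y C \<delta>)"

definition orth :: "('o, 'm, 'e, 'n, 'z) neg_ext_cat_scheme \<Rightarrow> 'm \<Rightarrow> 'm \<Rightarrow> bool" where
  "orth \<C> l r \<longleftrightarrow>
     carrier (Hom \<C> (cocone \<C> l) (cocone \<C> r)) = {\<one>\<^bsub>Hom \<C> (cocone \<C> l) (cocone \<C> r)\<^esub>} \<and>
     carrier (NExt \<C> (cocone \<C> l) (cocone \<C> r)) = {\<one>\<^bsub>NExt \<C> (cocone \<C> l) (cocone \<C> r)\<^esub>}"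

definition right_orth :: "('o, 'm, 'e, 'n, 'z) neg_ext_cat_scheme \<Rightarrow> 'm set \<Rightarrow> 'm set" where
  "right_orth \<C> J = {f \<in> deflations \<C>. \<forall>g \<in> J. orth \<C> g f}"

definition left_orth :: "('o, 'm, 'e, 'n, 'z) neg_ext_cat_scheme \<Rightarrow> 'm set \<Rightarrow> 'm set" where
  "left_orth \<C> J = {f \<in> deflations \<C>. \<forall>g \<in> J. orth \<C> f g}"

definition deflation_factorization_systems ::
  "('o, 'm, 'e, 'n, 'z) neg_ext_cat_scheme \<Rightarrow> ('m set \<times> 'm set) set" where
  "deflation_factorization_systems \<C> = {(\<L>, \<R>).
     \<L> \<subseteq> deflations \<C> \<and> \<R> \<subseteq> deflations \<C> \<and>
     (\<forall>B \<in> obj \<C>. \<forall>C \<in> obj \<C>. \<forall>f \<in> deflations \<C> \<inter> carrier (Hom \<C> B C).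
        \<exists>X \<in> obj \<C>. \<exists>l \<in> \<L> \<inter> carrier (Hom \<C> B X). \<exists>r \<in> \<R> \<inter> carrier (Hom \<C> X C).
          f = r \<cdot>\<^bsub>\<C>\<^esub> l) \<and>
     \<L> = left_orth \<C> \<R> \<and> right_orth \<C> \<L> = \<R>}"

definition Defl :: "('o, 'm, 'e, 'z) ext_cat_scheme \<Rightarrow> 'o set \<Rightarrow> 'm set" where
  "Defl \<C> \<U> = {f \<in> deflations \<C>. cocone \<C> f \<in> \<U>}"

definition Cocone :: "('o, 'm, 'e, 'z) ext_cat_scheme \<Rightarrow> 'm set \<Rightarrow> 'o set" where
  "Cocone \<C> J = {U \<in> obj \<C>. \<exists>f \<in> J. isomorphic \<C> U (cocone \<C> f)}"

end

theory Submission
  imports Defs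
begin

text \<open>
  The cocone of a deflation is unique up to isomorphism, and an \<open>\<E>\<close>-triangle with a zero end
  splits; in particular every object \<open>U\<close> is the cocone of the deflation \<open>U \<rightarrow> 0\<close>.  Hence orthogonality of
  deflations is the same as vanishing of \<open>\<C>(-,-)\<close> and \<open>\<E>\<^sup>-\<^sup>1(-,-)\<close> on cocones.
  A torsion triangle \<open>T \<rightarrow> A \<rightarrow> F\<close> of the cocone \<open>A\<close> of a deflation \<open>f\<close> yields, by (ET4), a
  factorization of \<open>f\<close> into deflations with cocones \<open>T\<close> and \<open>F\<close>; conversely a factorization of
  \<open>X \<rightarrow> 0\<close> yields a torsion triangle of \<open>X\<close>.  If \<open>A\<close> is orthogonal to \<open>\<F>\<close>, then the map \<open>A \<rightarrow> F\<close> is zero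
  and the exact sequence \<open>\<E>\<^sup>-\<^sup>1(T, F) \<rightarrow> \<C>(F, F) \<rightarrow> \<C>(A, F)\<close> shows that \<open>F\<close> is zero, so
  \<open>A \<cong> T\<close>; dually on the other side.
\<close>

section \<open>Zero morphisms, isomorphic objects and biproducts with a zero object\<close>

context additive_category
begin

lemma zero_closed [simp]:
  assumes "A \<in> obj \<C>" "B \<in> obj \<C>"
  shows "\<one>\<^bsub>Hom \<C> A B\<^esub> \<in> carrier (Hom \<C> A B)"
proof -
  interpret G: comm_group "Hom \<C> A B" using assms by (rule hom_comm_group)
  show ?thesis by simp
qed

text \<open>By additivity the composite equals its own double, and in a group only the neutral
  element does. The same argument gives \<open>zero_cmp\<close> and the vanishing lemmas for
  biadditive functors.\<close>

lemma cmp_zero: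
  assumes "A \<in> obj \<C>" "B \<in> obj \<C>" "C \<in> obj \<C>" "g \<in> carrier (Hom \<C> B C)"
  shows "g \<cdot> \<one>\<^bsub>Hom \<C> A B\<^esub> = \<one>\<^bsub>Hom \<C> A C\<^esub>"
proof -
  interpret G: comm_group "Hom \<C> A B" using assms(1,2) by (rule hom_comm_group)
  interpret H: comm_group "Hom \<C> A C" using assms(1,3) by (rule hom_comm_group)
  let ?z = "g \<cdot> \<one>\<^bsub>Hom \<C> A B\<^esub>"
  have c: "?z \<in> carrier (Hom \<C> A C)" using assms cmp_closed by simp
  have "?z \<otimes>\<^bsub>Hom \<C> A C\<^esub> ?z = ?z"
    using cmp_add_right[of A B C "\<one>\<^bsub>Hom \<C> A B\<^esub>" "\<one>\<^bsub>Hom \<C> A B\<^esub>" g] assms by simp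
  then show ?thesis using c by (metis H.l_cancel_one)
qed

lemma zero_cmp:
  assumes "A \<in> obj \<C>" "B \<in> obj \<C>" "C \<in> obj \<C>" "f \<in> carrier (Hom \<C> A B)"
  shows "\<one>\<^bsub>Hom \<C> B C\<^esub> \<cdot> f = \<one>\<^bsub>Hom \<C> A C\<^esub>"
proof -
  interpret G: comm_group "Hom \<C> B C" using assms(2,3) by (rule hom_comm_group)
  interpret H: comm_group "Hom \<C> A C" using assms(1,3) by (rule hom_comm_group)
  let ?z = "\<one>\<^bsub>Hom \<C> B C\<^esub> \<cdot> f"
  have c: "?z \<in> carrier (Hom \<C> A C)" using assms cmp_closed by simp
  have "?z \<otimes>\<^bsub>Hom \<C> A C\<^esub> ?z = ?z"
    using cmp_add_left[of A B C f "\<one>\<^bsub>Hom \<C> B C\<^esub>" "\<one>\<^bsub>Hom \<C> B C\<^esub>"] assms by simp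
  then show ?thesis using c by (metis H.l_cancel_one)
qed

lemma isomorphic_refl: "A \<in> obj \<C> \<Longrightarrow> isomorphic \<C> A A"
  unfolding isomorphic_def is_iso_def using idm_closed idm_cmp by blast

lemma isomorphic_sym: "isomorphic \<C> A B \<Longrightarrow> isomorphic \<C> B A"
  unfolding isomorphic_def is_iso_def by blast

lemma isomorphic_trans:
  assumes "isomorphic \<C> A B" "isomorphic \<C> B C"
  shows "isomorphic \<C> A C"
proof -
  have [simp]: "A \<in> obj \<C>" "B \<in> obj \<C>" "C \<in> obj \<C>" using assms by (auto simp: isomorphic_def)
  obtain f f' where f [simp]: "f \<in> carrier (Hom \<C> A B)" "f' \<in> carrier (Hom \<C> B A)"
      "f' \<cdot> f = idm \<C> A" "f \<cdot> f' = idm \<C> B"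
    using assms(1) by (auto simp: isomorphic_def is_iso_def)
  obtain g g' where g [simp]: "g \<in> carrier (Hom \<C> B C)" "g' \<in> carrier (Hom \<C> C B)"
      "g' \<cdot> g = idm \<C> B" "g \<cdot> g' = idm \<C> C"
    using assms(2) by (auto simp: isomorphic_def is_iso_def)
  have c [simp]: "g \<cdot> f \<in> carrier (Hom \<C> A C)" "f' \<cdot> g' \<in> carrier (Hom \<C> C A)"
    by (rule cmp_closed[of A B C] cmp_closed[of C B A]; simp)+
  have "(f' \<cdot> g') \<cdot> (g \<cdot> f) = f' \<cdot> (g' \<cdot> (g \<cdot> f))" by (rule cmp_assoc[of A C B A]) simp_all
  also have "g' \<cdot> (g \<cdot> f) = (g' \<cdot> g) \<cdot> f" by (rule cmp_assoc[of A B C B, symmetric]) simp_all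
  finally have 1: "(f' \<cdot> g') \<cdot> (g \<cdot> f) = idm \<C> A" using idm_cmp[of A B f] by simp
  have "(g \<cdot> f) \<cdot> (f' \<cdot> g') = g \<cdot> (f \<cdot> (f' \<cdot> g'))" by (rule cmp_assoc[of C A B C]) simp_all
  also have "f \<cdot> (f' \<cdot> g') = (f \<cdot> f') \<cdot> g'" by (rule cmp_assoc[of C B A B, symmetric]) simp_all
  finally have 2: "(g \<cdot> f) \<cdot> (f' \<cdot> g') = idm \<C> C" using idm_cmp[of C B g'] by simp
  show ?thesis unfolding isomorphic_def is_iso_def using 1 2 c \<open>A \<in> obj \<C>\<close> \<open>C \<in> obj \<C>\<close> by blast
qed

lemma hom_zero_domain:
  assumes "A \<in> obj \<C>" "B \<in> obj \<C>" "idm \<C> A = \<one>\<^bsub>Hom \<C> A A\<^esub>" "f \<in> carrier (Hom \<C> A B)"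
  shows "f = \<one>\<^bsub>Hom \<C> A B\<^esub>"
  using cmp_idm[of A B f] cmp_zero[of A A B f] assms by simp

lemma hom_zero_codomain:
  assumes "A \<in> obj \<C>" "B \<in> obj \<C>" "idm \<C> B = \<one>\<^bsub>Hom \<C> B B\<^esub>" "f \<in> carrier (Hom \<C> A B)"
  shows "f = \<one>\<^bsub>Hom \<C> A B\<^esub>"
  using idm_cmp[of A B f] zero_cmp[of A B B f] assms by simp

text \<open>From here on a zero object is recognised by the equation that its identity is zero; this
  is also the form in which objects are later proved to vanish.\<close>

lemma zero_obtain:
  obtains Z where "Z \<in> obj \<C>" "idm \<C> Z = \<one>\<^bsub>Hom \<C> Z Z\<^esub>"
proof -
  obtain Z where "zero_object \<C> Z" using zero_object_exists by blast
  then have "Z \<in> obj \<C>" "\<exists>!f. f \<in> carrier (Hom \<C> Z Z)" by (auto simp: zero_object_def)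
  then show thesis using that idm_closed zero_closed by blast
qed

text \<open>Taking \<open>A\<close> itself as the biproduct, rather than some object isomorphic to
  it, gives a split triangle whose middle term is literally \<open>A\<close>.\<close>

lemma biproduct_zero_right:
  assumes "A \<in> obj \<C>" "Z \<in> obj \<C>" "idm \<C> Z = \<one>\<^bsub>Hom \<C> Z Z\<^esub>"
  shows "biproduct \<C> A Z A (idm \<C> A) \<one>\<^bsub>Hom \<C> Z A\<^esub> (idm \<C> A) \<one>\<^bsub>Hom \<C> A Z\<^esub>"
proof -
  interpret G: comm_group "Hom \<C> A A" using assms(1,1) by (rule hom_comm_group)
  show ?thesis
    unfolding biproduct_def using assms by (simp add: idm_closed idm_cmp cmp_idm cmp_zero)
qed

lemma biproduct_zero_left:
  assumes "A \<in> obj \<C>" "Z \<in> obj \<C>" "idm \<C> Z = \<one>\<^bsub>Hom \<C> Z Z\<^esub>"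
  shows "biproduct \<C> Z A A \<one>\<^bsub>Hom \<C> Z A\<^esub> (idm \<C> A) \<one>\<^bsub>Hom \<C> A Z\<^esub> (idm \<C> A)"
proof -
  interpret G: comm_group "Hom \<C> A A" using assms(1,1) by (rule hom_comm_group)
  show ?thesis
    unfolding biproduct_def using assms by (simp add: idm_closed idm_cmp cmp_idm cmp_zero)
qed

text \<open>Conjugation: every \<open>u\<close> is
  \<open>g \<cdot> (g' \<cdot> u \<cdot> f) \<cdot> f'\<close>, and the bracket lies in the trivial
  group.\<close>

lemma hom_trivial_iso:
  assumes "isomorphic \<C> A A'" "isomorphic \<C> B B'"
    and triv: "carrier (Hom \<C> A B) = {\<one>\<^bsub>Hom \<C> A B\<^esub>}"
  shows "carrier (Hom \<C> A' B') = {\<one>\<^bsub>Hom \<C> A' B'\<^esub>}"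
proof -
  have [simp]: "A \<in> obj \<C>" "A' \<in> obj \<C>" "B \<in> obj \<C>" "B' \<in> obj \<C>"
    using assms by (auto simp: isomorphic_def)
  obtain f f' where f [simp]: "f \<in> carrier (Hom \<C> A A')" "f' \<in> carrier (Hom \<C> A' A)"
      "f \<cdot> f' = idm \<C> A'"
    using assms(1) by (auto simp: isomorphic_def is_iso_def)
  obtain g g' where g [simp]: "g \<in> carrier (Hom \<C> B B')" "g' \<in> carrier (Hom \<C> B' B)"
      "g \<cdot> g' = idm \<C> B'"
    using assms(2) by (auto simp: isomorphic_def is_iso_def)
  have "u = \<one>\<^bsub>Hom \<C> A' B'\<^esub>" if u [simp]: "u \<in> carrier (Hom \<C> A' B')" for u
  proof -
    have [simp]: "u \<cdot> f \<in> carrier (Hom \<C> A B')" by (rule cmp_closed[of A A']) simp_all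
    have "g' \<cdot> (u \<cdot> f) \<in> carrier (Hom \<C> A B)" by (rule cmp_closed[of A B' B]) simp_all
    then have z: "g' \<cdot> (u \<cdot> f) = \<one>\<^bsub>Hom \<C> A B\<^esub>" using triv by simp
    have "u \<cdot> f = idm \<C> B' \<cdot> (u \<cdot> f)" by (rule idm_cmp[of A B', symmetric]) simp_all
    also have "\<dots> = g \<cdot> (g' \<cdot> (u \<cdot> f))"
      by (subst g(3)[symmetric], rule cmp_assoc[of A B' B B']) simp_all
    also have "\<dots> = \<one>\<^bsub>Hom \<C> A B'\<^esub>" using z by (simp add: cmp_zero)
    finally have z': "u \<cdot> f = \<one>\<^bsub>Hom \<C> A B'\<^esub>" .
    have "u = u \<cdot> idm \<C> A'" by (rule cmp_idm[of A' B', symmetric]) simp_all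
    also have "\<dots> = (u \<cdot> f) \<cdot> f'"
      by (subst f(3)[symmetric], rule cmp_assoc[of A' A A' B', symmetric]) simp_all
    finally show ?thesis using z' by (simp add: zero_cmp)
  qed
  then show ?thesis by auto
qed

end

section \<open>Vanishing and isomorphism invariance for biadditive functors\<close>

context additive_bifunctor
begin

lemma bif_zero_right:
  assumes "C \<in> obj \<C>" "A \<in> obj \<C>" "A' \<in> obj \<C>" "\<delta> \<in> carrier (F C A)"
  shows "Fm (idm \<C> C) \<one>\<^bsub>Hom \<C> A A'\<^esub> \<delta> = \<one>\<^bsub>F C A'\<^esub>"
proof -
  interpret G: comm_group "Hom \<C> A A'" using assms(2,3) by (rule hom_comm_group)
  interpret H: comm_group "F C A'" using assms(1,3) by (rule bif_comm_group)
  let ?z = "Fm (idm \<C> C) \<one>\<^bsub>Hom \<C> A A'\<^esub> \<delta>"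
  have c: "?z \<in> carrier (F C A')"
    using bif_hom[of C C A A' "idm \<C> C" "\<one>\<^bsub>Hom \<C> A A'\<^esub>"] assms idm_closed
    by (auto simp: hom_def)
  have "?z \<otimes>\<^bsub>F C A'\<^esub> ?z = ?z"
    using bif_add_right[of C A A' "\<one>\<^bsub>Hom \<C> A A'\<^esub>" "\<one>\<^bsub>Hom \<C> A A'\<^esub>" \<delta>] assms by simp
  then show ?thesis using c by (metis H.l_cancel_one)
qed

lemma bif_zero_left:
  assumes "C \<in> obj \<C>" "C' \<in> obj \<C>" "A \<in> obj \<C>" "\<delta> \<in> carrier (F C A)"
  shows "Fm \<one>\<^bsub>Hom \<C> C' C\<^esub> (idm \<C> A) \<delta> = \<one>\<^bsub>F C' A\<^esub>"
proof -
  interpret G: comm_group "Hom \<C> C' C" using assms(2,1) by (rule hom_comm_group)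
  interpret H: comm_group "F C' A" using assms(2,3) by (rule bif_comm_group)
  let ?z = "Fm \<one>\<^bsub>Hom \<C> C' C\<^esub> (idm \<C> A) \<delta>"
  have c: "?z \<in> carrier (F C' A)"
    using bif_hom[of C C' A A "\<one>\<^bsub>Hom \<C> C' C\<^esub>" "idm \<C> A"] assms idm_closed
    by (auto simp: hom_def)
  have "?z \<otimes>\<^bsub>F C' A\<^esub> ?z = ?z"
    using bif_add_left[of C C' A "\<one>\<^bsub>Hom \<C> C' C\<^esub>" "\<one>\<^bsub>Hom \<C> C' C\<^esub>" \<delta>] assms by simp
  then show ?thesis using c by (metis H.l_cancel_one)
qed

text \<open>The identity of \<open>F C' A'\<close> factors through the trivial group
  \<open>F C A\<close>. Contravariance in the first argument pairs \<open>f\<close> with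
  \<open>g'\<close> on the way in and \<open>f'\<close> with \<open>g\<close> on the way
  out.\<close>

lemma bif_trivial_iso:
  assumes "isomorphic \<C> C C'" "isomorphic \<C> A A'"
    and triv: "carrier (F C A) = {\<one>\<^bsub>F C A\<^esub>}"
  shows "carrier (F C' A') = {\<one>\<^bsub>F C' A'\<^esub>}"
proof -
  have [simp]: "A \<in> obj \<C>" "A' \<in> obj \<C>" "C \<in> obj \<C>" "C' \<in> obj \<C>"
    using assms by (auto simp: isomorphic_def)
  obtain f f' where f [simp]: "f \<in> carrier (Hom \<C> C C')" "f' \<in> carrier (Hom \<C> C' C)"
      "f \<cdot> f' = idm \<C> C'"
    using assms(1) by (auto simp: isomorphic_def is_iso_def)
  obtain g g' where g [simp]: "g \<in> carrier (Hom \<C> A A')" "g' \<in> carrier (Hom \<C> A' A)"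
      "g \<cdot> g' = idm \<C> A'"
    using assms(2) by (auto simp: isomorphic_def is_iso_def)
  interpret H: comm_group "F C A" by (rule bif_comm_group) simp_all
  interpret H': comm_group "F C' A'" by (rule bif_comm_group) simp_all
  interpret h: group_hom "F C A" "F C' A'" "Fm f' g"
    by unfold_locales (rule bif_hom; simp)
  have "u = \<one>\<^bsub>F C' A'\<^esub>" if u [simp]: "u \<in> carrier (F C' A')" for u
  proof -
    have "Fm f g' \<in> hom (F C' A') (F C A)" by (rule bif_hom) simp_all
    then have "Fm f g' u \<in> carrier (F C A)" by (auto simp: hom_def)
    then have z: "Fm f g' u = \<one>\<^bsub>F C A\<^esub>" using triv by simp
    have "u = Fm (f \<cdot> f') (g \<cdot> g') u" by (simp add: bif_idm)
    also have "\<dots> = Fm f' g (Fm f g' u)"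
      by (rule bif_cmp[of C' C C' A' A A']) simp_all
    finally show ?thesis using z by simp
  qed
  then show ?thesis by auto
qed

end

section \<open>Split triangles and uniqueness of the cocone\<close>

context extriangulated_category
begin

lemma E_triangleD:
  assumes "E_triangle \<C> A x B y C \<delta>"
  shows "A \<in> obj \<C>" "B \<in> obj \<C>" "C \<in> obj \<C>" "x \<in> carrier (Hom \<C> A B)"
    "y \<in> carrier (Hom \<C> B C)" "\<delta> \<in> carrier (Ext \<C> C A)"
  using assms by (simp_all add: E_triangle_def)

lemma E_triangle_split:
  assumes "biproduct \<C> A C P i j p q"
  shows "E_triangle \<C> A i P q C \<one>\<^bsub>Ext \<C> C A\<^esub>"
proof -
  have "A \<in> obj \<C>" "C \<in> obj \<C>" using assms by (auto simp: biproduct_def)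
  then interpret H: comm_group "Ext \<C> C A" using bif_comm_group by blast
  show ?thesis using assms realize_zero[OF assms] by (auto simp: biproduct_def E_triangle_def)
qed

lemma E_triangle_class_iso:
  assumes E: "E_triangle \<C> A x B y C \<delta>" and E': "E_triangle \<C> A x' B' y' C \<delta>"
  shows "isomorphic \<C> B B'"
proof -
  note o = E_triangleD[OF E] E_triangleD[OF E']
  have "is_iso \<C> B' B' (idm \<C> B')"
    using o idm_closed idm_cmp by (auto simp: is_iso_def)
  then have "((x', y'), (x', y')) \<in> seq_equiv \<C> A C"
    unfolding seq_equiv_def using o idm_cmp cmp_idm by blast
  then have "(x', y') \<in> seq_class \<C> A C x' y'" by (simp add: seq_class_def)
  then have "(x', y') \<in> seq_class \<C> A C x y" using E E' by (simp add: E_triangle_def)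
  then obtain D D' b where D: "D \<in> obj \<C>" "D' \<in> obj \<C>" "x \<in> carrier (Hom \<C> A D)"
      "x' \<in> carrier (Hom \<C> A D')" "is_iso \<C> D D' b"
    by (auto simp: seq_class_def seq_equiv_def)
  \<comment> \<open>A sequence is stored as a pair of arrows without its middle object; disjointness
    of Hom-sets recovers that object.\<close>
  then have "D = B" "D' = B'" using o hom_disjoint by blast+
  then show ?thesis using D by (auto simp: isomorphic_def)
qed

text \<open>The extension is its own pullback along the identity of \<open>Z\<close>, which is a
  zero morphism, so it vanishes; its realization is then also given by the split sequence with
  middle term \<open>A\<close>.\<close>

lemma E_triangle_zero_right:
  assumes E: "E_triangle \<C> A x B y Z \<delta>" and Z: "idm \<C> Z = \<one>\<^bsub>Hom \<C> Z Z\<^esub>"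
  shows "isomorphic \<C> A B"
proof -
  note o = E_triangleD[OF E]
  have "\<delta> = \<one>\<^bsub>Ext \<C> Z A\<^esub>"
    using bif_idm[of Z A \<delta>] bif_zero_left[of Z Z A \<delta>] Z o by simp
  then show ?thesis
    using E_triangle_split[OF biproduct_zero_right[of A Z]] E_triangle_class_iso E o Z by blast
qed

lemma E_triangle_zero_left:
  assumes E: "E_triangle \<C> Z x B y C \<delta>" and Z: "idm \<C> Z = \<one>\<^bsub>Hom \<C> Z Z\<^esub>"
  shows "isomorphic \<C> C B"
proof -
  note o = E_triangleD[OF E]
  have "\<delta> = \<one>\<^bsub>Ext \<C> C Z\<^esub>"
    using bif_idm[of C Z \<delta>] bif_zero_right[of C Z Z \<delta>] Z o by simp
  then show ?thesis
    using E_triangle_split[OF biproduct_zero_left[of C Z]] E_triangle_class_iso E o Z by blast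
qed

text \<open>(ET3), applied to the map from the split triangle on \<open>A\<close> and
  \<open>Z\<close> into the given one, factors \<open>y \<cdot> x\<close> through a zero
  object.\<close>

lemma E_triangle_cmp_zero:
  assumes E: "E_triangle \<C> A x B y C \<delta>"
  shows "y \<cdot> x = \<one>\<^bsub>Hom \<C> A C\<^esub>"
proof -
  note o = E_triangleD[OF E]
  obtain Z where Z: "Z \<in> obj \<C>" "idm \<C> Z = \<one>\<^bsub>Hom \<C> Z Z\<^esub>" by (rule zero_obtain)
  obtain c where "c \<in> carrier (Hom \<C> Z C)" "c \<cdot> \<one>\<^bsub>Hom \<C> A Z\<^esub> = y \<cdot> x"
    using ET3[OF E_triangle_split[OF biproduct_zero_right[of A Z]] E, of "idm \<C> A" x] o Z idm_closed
    by auto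
  then show ?thesis using cmp_zero o Z by metis
qed

text \<open>This is exactness of C(B,W) -> C(A,W) -> E(C,W) at the middle term. The pair
  (\<open>u\<close>, 0) is a morphism from \<open>\<delta>\<close> to the zero extension realized by
  the split triangle on \<open>W\<close> and \<open>Z\<close>, and its completion on middle terms is
  the required \<open>t\<close>.\<close>

lemma factor_inflation:
  assumes E: "E_triangle \<C> A x B y C \<delta>" and W: "W \<in> obj \<C>"
    and u: "u \<in> carrier (Hom \<C> A W)" and z: "push \<C> C u \<delta> = \<one>\<^bsub>Ext \<C> C W\<^esub>"
  obtains t where "t \<in> carrier (Hom \<C> B W)" "t \<cdot> x = u"
proof -
  note o = E_triangleD[OF E]
  obtain Z where Z: "Z \<in> obj \<C>" "idm \<C> Z = \<one>\<^bsub>Hom \<C> Z Z\<^esub>" by (rule zero_obtain)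
  interpret H: comm_group "Ext \<C> Z W" using Z W bif_comm_group by blast
  have "pull \<C> W \<one>\<^bsub>Hom \<C> C Z\<^esub> \<one>\<^bsub>Ext \<C> Z W\<^esub> = \<one>\<^bsub>Ext \<C> C W\<^esub>"
    unfolding pull_def using bif_zero_left[of Z C W] Z W o by simp
  then obtain b where b: "b \<in> carrier (Hom \<C> B W)" "b \<cdot> x = idm \<C> W \<cdot> u"
    using realize_morphism[OF E E_triangle_split[OF biproduct_zero_right[of W Z]],
        of u "\<one>\<^bsub>Hom \<C> C Z\<^esub>"] W Z u z o by auto
  then show thesis using that idm_cmp W o u by metis
qed

text \<open>A deflation is a weak cokernel of its inflation: apply (ET3) to the map (0,
  \<open>v\<close>) into the split triangle on \<open>Z\<close> and \<open>W\<close>.\<close>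

lemma factor_deflation:
  assumes E: "E_triangle \<C> A x B y C \<delta>" and W: "W \<in> obj \<C>"
    and v: "v \<in> carrier (Hom \<C> B W)" and z: "v \<cdot> x = \<one>\<^bsub>Hom \<C> A W\<^esub>"
  obtains c where "c \<in> carrier (Hom \<C> C W)" "c \<cdot> y = v"
proof -
  note o = E_triangleD[OF E]
  obtain Z where Z: "Z \<in> obj \<C>" "idm \<C> Z = \<one>\<^bsub>Hom \<C> Z Z\<^esub>" by (rule zero_obtain)
  have "v \<cdot> x = \<one>\<^bsub>Hom \<C> Z W\<^esub> \<cdot> \<one>\<^bsub>Hom \<C> A Z\<^esub>" using z zero_cmp[of A Z W] o Z W by simp
  then obtain c where "c \<in> carrier (Hom \<C> C W)" "c \<cdot> y = idm \<C> W \<cdot> v"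
    using ET3[OF E E_triangle_split[OF biproduct_zero_left[of W Z]], of "\<one>\<^bsub>Hom \<C> A Z\<^esub>" v] W Z v o
    by auto
  then show thesis using that idm_cmp W o v by metis
qed

text \<open>
  (ET3)\<open>\<^sup>o\<^sup>p\<close> gives comparison maps \<open>a\<close>, \<open>a'\<close> in both directions.  The difference \<open>1 - a'a\<close>
  kills \<open>\<delta>\<close>, so it factors as \<open>t x\<close>, and \<open>a' + t x'\<close> is a left inverse of \<open>a\<close>;
  moreover \<open>a\<close> is an epimorphism.
\<close>

lemma E_triangle_cocone_unique:
  assumes E: "E_triangle \<C> A x B y C \<delta>" and E': "E_triangle \<C> A' x' B y C \<delta>'"
  shows "isomorphic \<C> A A'"
proof -
  note o [simp] = E_triangleD[OF E] E_triangleD[OF E'] idm_closed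
  have y: "idm \<C> C \<cdot> y = y \<cdot> idm \<C> B" using idm_cmp[of B C] cmp_idm[of B C] by simp
  obtain a where a [simp]: "a \<in> carrier (Hom \<C> A A')" and xa: "idm \<C> B \<cdot> x = x' \<cdot> a"
      and pa: "push \<C> C a \<delta> = pull \<C> A' (idm \<C> C) \<delta>'"
    using ET3_op[OF E E' _ _ y] by auto
  obtain a' where a' [simp]: "a' \<in> carrier (Hom \<C> A' A)"
      and pa': "push \<C> C a' \<delta>' = pull \<C> A (idm \<C> C) \<delta>"
    using ET3_op[OF E' E _ _ y] by auto
  have x: "x' \<cdot> a = x" using xa idm_cmp[of A B] by simp
  have p: "push \<C> C a \<delta> = \<delta>'" "push \<C> C a' \<delta>' = \<delta>"
    using pa pa' bif_idm by (simp_all add: pull_def)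
  have push_cmp: "push \<C> C (v \<cdot> u) \<epsilon> = push \<C> C v (push \<C> C u \<epsilon>)"
    if "K \<in> obj \<C>" "L \<in> obj \<C>" "M \<in> obj \<C>" "u \<in> carrier (Hom \<C> K L)"
      "v \<in> carrier (Hom \<C> L M)" "\<epsilon> \<in> carrier (Ext \<C> C K)" for u v \<epsilon> K L M
    using bif_cmp[of C C C K L M "idm \<C> C" "idm \<C> C" u v \<epsilon>] that cmp_idm[of C C]
    by (simp add: push_def)
  \<comment> \<open>Since \<open>\<delta>'\<close> is the pushforward of \<open>\<delta>\<close>
    along \<open>a\<close>, \<open>u\<close> kills \<open>\<delta>'\<close> and so is some
    \<open>v \<cdot> x'\<close>. Then \<open>v\<close> kills \<open>x\<close>, which is
    \<open>x' \<cdot> a\<close>, so \<open>v\<close> is some \<open>w \<cdot> y\<close>; hence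
    \<open>u\<close> is \<open>w \<cdot> y \<cdot> x'\<close>, which is zero.\<close>
  have epi: "u = \<one>\<^bsub>Hom \<C> A' W\<^esub>"
    if W [simp]: "W \<in> obj \<C>" and u [simp]: "u \<in> carrier (Hom \<C> A' W)"
      and ua: "u \<cdot> a = \<one>\<^bsub>Hom \<C> A W\<^esub>" for u W
  proof -
    have "push \<C> C u \<delta>' = push \<C> C (u \<cdot> a) \<delta>" using push_cmp[of A A' W a u \<delta>] p by simp
    also have "\<dots> = \<one>\<^bsub>Ext \<C> C W\<^esub>" using ua bif_zero_right[of C A W \<delta>] by (simp add: push_def)
    finally obtain v where v [simp]: "v \<in> carrier (Hom \<C> B W)" and vx: "v \<cdot> x' = u"
      using factor_inflation[OF E' W u] by blast
    have "v \<cdot> x = (v \<cdot> x') \<cdot> a" using x cmp_assoc[of A A' B W a x' v] by simp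
    then obtain w where w: "w \<in> carrier (Hom \<C> C W)" "w \<cdot> y = v"
      using factor_deflation[OF E W v] vx ua by metis
    have "u = w \<cdot> (y \<cdot> x')" using cmp_assoc[of A' B C W x' y w] w vx by simp
    then show ?thesis using E_triangle_cmp_zero[OF E'] cmp_zero w by simp
  qed
  interpret G: comm_group "Hom \<C> A A" by (rule hom_comm_group) simp_all
  interpret G': comm_group "Hom \<C> A' A'" by (rule hom_comm_group) simp_all
  interpret H: comm_group "Hom \<C> A' A" by (rule hom_comm_group) simp_all
  interpret X: comm_group "Ext \<C> C A" by (rule bif_comm_group) simp_all
  have aa [simp]: "a' \<cdot> a \<in> carrier (Hom \<C> A A)" by (rule cmp_closed[of A A']) simp_all
  define d where "d = idm \<C> A \<otimes>\<^bsub>Hom \<C> A A\<^esub> inv\<^bsub>Hom \<C> A A\<^esub> (a' \<cdot> a)"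
  have d [simp]: "d \<in> carrier (Hom \<C> A A)" by (simp add: d_def)
  have dd: "d \<otimes>\<^bsub>Hom \<C> A A\<^esub> (a' \<cdot> a) = idm \<C> A" by (simp add: d_def G.m_assoc)
  have "Ext_map \<C> (idm \<C> C) d \<in> hom (Ext \<C> C A) (Ext \<C> C A)" by (rule bif_hom) simp_all
  then have pd [simp]: "push \<C> C d \<delta> \<in> carrier (Ext \<C> C A)" by (auto simp: push_def hom_def)
  have "push \<C> C d \<delta> \<otimes>\<^bsub>Ext \<C> C A\<^esub> push \<C> C (a' \<cdot> a) \<delta> = \<delta>"
    using bif_add_right[of C A A d "a' \<cdot> a" \<delta>] dd bif_idm by (simp add: push_def)
  moreover have "push \<C> C (a' \<cdot> a) \<delta> = \<delta>" using push_cmp[of A A' A a a' \<delta>] p by simp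
  ultimately have "push \<C> C d \<delta> = \<one>\<^bsub>Ext \<C> C A\<^esub>" using X.r_cancel_one o pd by metis
  then obtain t where t [simp]: "t \<in> carrier (Hom \<C> B A)" and tx: "t \<cdot> x = d"
    using factor_inflation[OF E _ d] by auto
  have tx' [simp]: "t \<cdot> x' \<in> carrier (Hom \<C> A' A)" by (rule cmp_closed[of A' B]) simp_all
  define s where "s = (t \<cdot> x') \<otimes>\<^bsub>Hom \<C> A' A\<^esub> a'"
  have s [simp]: "s \<in> carrier (Hom \<C> A' A)" by (simp add: s_def)
  have "(t \<cdot> x') \<cdot> a = d" using cmp_assoc[of A A' B A a x' t] x tx by simp
  then have sa: "s \<cdot> a = idm \<C> A"
    using cmp_add_left[of A A' A a "t \<cdot> x'" a'] dd by (simp add: s_def)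
  have as [simp]: "a \<cdot> s \<in> carrier (Hom \<C> A' A')" by (rule cmp_closed[of A' A]) simp_all
  \<comment> \<open>Additively \<open>e\<close> is as - 1. It kills \<open>a\<close> because
    \<open>s\<close> is a left inverse of \<open>a\<close>, so \<open>epi\<close> makes
    \<open>s\<close> a right inverse too.\<close>
  define e where "e = (a \<cdot> s) \<otimes>\<^bsub>Hom \<C> A' A'\<^esub> inv\<^bsub>Hom \<C> A' A'\<^esub> (idm \<C> A')"
  have e [simp]: "e \<in> carrier (Hom \<C> A' A')" by (simp add: e_def)
  have ee: "e \<otimes>\<^bsub>Hom \<C> A' A'\<^esub> idm \<C> A' = a \<cdot> s" by (simp add: e_def G'.m_assoc)
  interpret K: comm_group "Hom \<C> A A'" by (rule hom_comm_group) simp_all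
  have ea: "e \<cdot> a \<in> carrier (Hom \<C> A A')" by (rule cmp_closed[of A A']) simp_all
  have "(e \<cdot> a) \<otimes>\<^bsub>Hom \<C> A A'\<^esub> a = (a \<cdot> s) \<cdot> a"
    using cmp_add_left[of A A' A' a e "idm \<C> A'"] ee idm_cmp[of A A' a] by simp
  also have "\<dots> = a" using cmp_assoc[of A A' A A' a s a] sa cmp_idm[of A A'] by simp
  finally have "e \<cdot> a = \<one>\<^bsub>Hom \<C> A A'\<^esub>" using K.r_cancel_one ea a by metis
  then have "e = \<one>\<^bsub>Hom \<C> A' A'\<^esub>" by (intro epi) simp_all
  then have "a \<cdot> s = idm \<C> A'" using ee by simp
  then show ?thesis unfolding isomorphic_def is_iso_def using sa a s o by blast
qed

section \<open>Chosen cocones and the operations \<open>Defl\<close> and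
  \<open>Cocone\<close>\<close>

lemma deflation_triangle:
  assumes "y \<in> deflations \<C>" "B \<in> obj \<C>" "C \<in> obj \<C>" "y \<in> carrier (Hom \<C> B C)"
  obtains x \<delta> where "E_triangle \<C> (cocone \<C> y) x B y C \<delta>"
proof -
  have "\<exists>A x B C \<delta>. E_triangle \<C> A x B y C \<delta>" using assms(1) by (simp add: deflations_def)
  then have "\<exists>x B C \<delta>. E_triangle \<C> (cocone \<C> y) x B y C \<delta>"
    unfolding cocone_def by (rule someI_ex)
  then obtain x B' C' \<delta> where E: "E_triangle \<C> (cocone \<C> y) x B' y C' \<delta>" by blast
  \<comment> \<open>The choice made in \<open>cocone\<close> fixes only the first object; the other
    two are determined by the arrow \<open>y\<close>.\<close>
  have "B' = B \<and> C' = C" using hom_disjoint[of B' C' B C y] assms E_triangleD[OF E] by blast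
  then show thesis using that E by blast
qed

lemma cocone_obj: "y \<in> deflations \<C> \<Longrightarrow> cocone \<C> y \<in> obj \<C>"
  unfolding deflations_def cocone_def mem_Collect_eq by (drule someI_ex) (auto dest: E_triangleD)

lemma cocone_iso:
  assumes E: "E_triangle \<C> A x B y C \<delta>"
  shows "y \<in> deflations \<C>" "isomorphic \<C> A (cocone \<C> y)"
proof -
  show d: "y \<in> deflations \<C>" using E unfolding deflations_def by blast
  note o = E_triangleD[OF E]
  obtain x' \<delta>' where "E_triangle \<C> (cocone \<C> y) x' B y C \<delta>'"
    using deflation_triangle[OF d o(2,3,5)] by blast
  then show "isomorphic \<C> A (cocone \<C> y)" by (rule E_triangle_cocone_unique[OF E])
qed

lemma to_zero_deflation:
  assumes "U \<in> obj \<C>"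
  obtains Z y where "Z \<in> obj \<C>" "idm \<C> Z = \<one>\<^bsub>Hom \<C> Z Z\<^esub>" "y \<in> carrier (Hom \<C> U Z)"
    "y \<in> deflations \<C>" "isomorphic \<C> U (cocone \<C> y)"
proof -
  obtain Z where Z: "Z \<in> obj \<C>" "idm \<C> Z = \<one>\<^bsub>Hom \<C> Z Z\<^esub>" by (rule zero_obtain)
  show thesis
    by (rule that[OF Z _ cocone_iso[OF E_triangle_split[OF biproduct_zero_right[OF assms Z]]]])
      (use assms Z in simp)
qed

text \<open>For the inclusion from right to left, \<open>U\<close> is up to isomorphism the cocone
  of a deflation to a zero object, and closure under isomorphism carries membership from
  \<open>U\<close> to the chosen cocone.\<close>

lemma Cocone_Defl:
  assumes "subcategory \<C> \<U>"
  shows "Cocone \<C> (Defl \<C> \<U>) = \<U>"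
proof (intro equalityI subsetI)
  fix U assume "U \<in> Cocone \<C> (Defl \<C> \<U>)"
  then show "U \<in> \<U>"
    using assms isomorphic_sym by (auto simp: Cocone_def Defl_def subcategory_def)
next
  fix U assume U: "U \<in> \<U>"
  then have "U \<in> obj \<C>" using assms by (auto simp: subcategory_def)
  then obtain y where y: "y \<in> deflations \<C>" "isomorphic \<C> U (cocone \<C> y)"
    using to_zero_deflation by blast
  then have "cocone \<C> y \<in> \<U>" using assms U by (auto simp: subcategory_def)
  then show "U \<in> Cocone \<C> (Defl \<C> \<U>)"
    using y \<open>U \<in> obj \<C>\<close> by (auto simp: Cocone_def Defl_def)
qed

lemma subcategory_Cocone: "subcategory \<C> (Cocone \<C> J)"
proof -
  have "B \<in> Cocone \<C> J" if A: "A \<in> Cocone \<C> J" and AB: "isomorphic \<C> A B" for A B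
  proof -
    obtain f where "f \<in> J" "isomorphic \<C> A (cocone \<C> f)" using A by (auto simp: Cocone_def)
    moreover have "B \<in> obj \<C>" using AB by (simp add: isomorphic_def)
    ultimately show ?thesis
      unfolding Cocone_def using isomorphic_trans[OF isomorphic_sym[OF AB]] by blast
  qed
  moreover have "Cocone \<C> J \<subseteq> obj \<C>" by (auto simp: Cocone_def)
  ultimately show ?thesis unfolding subcategory_def by blast
qed

lemma cocone_in_Cocone: "f \<in> J \<Longrightarrow> f \<in> deflations \<C> \<Longrightarrow> cocone \<C> f \<in> Cocone \<C> J"
  using isomorphic_refl[OF cocone_obj] cocone_obj by (auto simp: Cocone_def)

end

section \<open>Orthogonality of objects and degenerate torsion triangles\<close>

context neg_extriangulated_category
begin

text \<open>Despite the name, negative extensions are included. Moving \<open>orth\<close> from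
  deflations to objects lets cocones be replaced by isomorphic objects.\<close>

definition hom_orth :: "'o \<Rightarrow> 'o \<Rightarrow> bool" where
  "hom_orth A B \<longleftrightarrow> carrier (Hom \<C> A B) = {\<one>\<^bsub>Hom \<C> A B\<^esub>} \<and>
     carrier (NExt \<C> A B) = {\<one>\<^bsub>NExt \<C> A B\<^esub>}"

lemma hom_orth_iso:
  "\<lbrakk>hom_orth A B; isomorphic \<C> A A'; isomorphic \<C> B B'\<rbrakk> \<Longrightarrow> hom_orth A' B'"
  unfolding hom_orth_def using hom_trivial_iso N.bif_trivial_iso by blast

lemma orth_iff: "orth \<C> l r \<longleftrightarrow> hom_orth (cocone \<C> l) (cocone \<C> r)"
  by (simp add: orth_def hom_orth_def)

lemma s_torsion_pairs_iff:
  "(\<T>, \<F>) \<in> s_torsion_pairs \<C> \<longleftrightarrow> subcategory \<C> \<T> \<and> subcategory \<C> \<F> \<and>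
     (\<forall>X \<in> obj \<C>. \<exists>T \<in> \<T>. \<exists>F \<in> \<F>. \<exists>f g \<delta>. E_triangle \<C> T f X g F \<delta>) \<and>
     (\<forall>T \<in> \<T>. \<forall>F \<in> \<F>. hom_orth T F)"
  unfolding s_torsion_pairs_def hom_orth_def by blast

text \<open>The identity of \<open>F\<close> maps to \<open>g = 0\<close>, so it comes from \<open>\<E>\<^sup>-\<^sup>1(T, F) = 0\<close>.\<close>

lemma torsion_part_iso:
  assumes E: "E_triangle \<C> T f A g F \<delta>" and TF: "hom_orth T F" and AF: "hom_orth A F"
  shows "isomorphic \<C> T A"
proof (rule E_triangle_zero_right[OF E])
  note o = E_triangleD[OF E]
  interpret G: comm_group "Hom \<C> F F" using o hom_comm_group by blast
  interpret H: comm_group "NExt \<C> T F" using o N.bif_comm_group by blast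
  interpret s: group_hom "NExt \<C> T F" "Hom \<C> F F" "sharp_con \<C> F T \<delta> F"
    using o sharp_con_hom by unfold_locales blast
  have "g = \<one>\<^bsub>Hom \<C> A F\<^esub>" using AF o by (simp add: hom_orth_def)
  then have "idm \<C> F \<in> kernel (Hom \<C> F F) (Hom \<C> A F) (\<lambda>u. u \<cdot> g)"
    using o idm_closed idm_cmp by (simp add: kernel_def)
  then have "idm \<C> F \<in> sharp_con \<C> F T \<delta> F ` carrier (NExt \<C> T F)"
    using exact_con[OF E o(3)] by (simp add: exact_at_def)
  then show "idm \<C> F = \<one>\<^bsub>Hom \<C> F F\<^esub>" using TF by (simp add: hom_orth_def)
qed

text \<open>Dually, \<open>f\<close> is zero, so the covariant exact sequence E^-1(T,F) -> C(T,T) ->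
  C(T,A) puts the identity of \<open>T\<close> in the image of a trivial group.\<close>

lemma torsion_free_part_iso:
  assumes E: "E_triangle \<C> T f A g F \<delta>" and TF: "hom_orth T F" and TA: "hom_orth T A"
  shows "isomorphic \<C> F A"
proof (rule E_triangle_zero_left[OF E])
  note o = E_triangleD[OF E]
  interpret G: comm_group "Hom \<C> T T" using o hom_comm_group by blast
  interpret H: comm_group "NExt \<C> T F" using o N.bif_comm_group by blast
  interpret s: group_hom "NExt \<C> T F" "Hom \<C> T T" "sharp_cov \<C> F T \<delta> T"
    using o sharp_cov_hom by unfold_locales blast
  have "f = \<one>\<^bsub>Hom \<C> T A\<^esub>" using TA o by (simp add: hom_orth_def)
  then have "idm \<C> T \<in> kernel (Hom \<C> T T) (Hom \<C> T A) (\<lambda>u. f \<cdot> u)"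
    using o idm_closed cmp_idm by (simp add: kernel_def)
  then have "idm \<C> T \<in> sharp_cov \<C> F T \<delta> T ` carrier (NExt \<C> T F)"
    using exact_cov[OF E o(1)] by (simp add: exact_at_def)
  then show "idm \<C> T = \<one>\<^bsub>Hom \<C> T T\<^esub>" using TF by (simp add: hom_orth_def)
qed

section \<open>From s-torsion pairs to deflation factorization systems\<close>

lemma left_orth_Defl:
  assumes "(\<T>, \<F>) \<in> s_torsion_pairs \<C>"
  shows "left_orth \<C> (Defl \<C> \<F>) = Defl \<C> \<T>"
proof (intro equalityI subsetI)
  fix f assume "f \<in> Defl \<C> \<T>"
  then show "f \<in> left_orth \<C> (Defl \<C> \<F>)"
    using assms by (auto simp: s_torsion_pairs_iff left_orth_def Defl_def orth_iff)
next
  fix f assume "f \<in> left_orth \<C> (Defl \<C> \<F>)"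
  then have f: "f \<in> deflations \<C>" and
    o: "\<And>g. g \<in> Defl \<C> \<F> \<Longrightarrow> hom_orth (cocone \<C> f) (cocone \<C> g)"
    by (auto simp: left_orth_def orth_iff)
  have A: "cocone \<C> f \<in> obj \<C>" using f by (rule cocone_obj)
  then obtain T F u v \<delta> where T: "T \<in> \<T>" and F: "F \<in> \<F>"
      and E: "E_triangle \<C> T u (cocone \<C> f) v F \<delta>"
    using assms by (auto simp: s_torsion_pairs_iff)
  \<comment> \<open>The hypothesis on \<open>f\<close> speaks only of cocones of deflations, so
    \<open>F\<close> has to be presented as one, up to isomorphism, before orthogonality applies to
    it.\<close>
  have "F \<in> Cocone \<C> (Defl \<C> \<F>)" using F assms Cocone_Defl by (simp add: s_torsion_pairs_iff)
  then obtain g where "g \<in> Defl \<C> \<F>" "isomorphic \<C> F (cocone \<C> g)" by (auto simp: Cocone_def)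
  then have "hom_orth (cocone \<C> f) F"
    using o hom_orth_iso isomorphic_sym isomorphic_refl[OF A] by blast
  then have "isomorphic \<C> T (cocone \<C> f)"
    using torsion_part_iso[OF E] assms T F by (auto simp: s_torsion_pairs_iff)
  then show "f \<in> Defl \<C> \<T>"
    using assms T f by (auto simp: s_torsion_pairs_iff subcategory_def Defl_def)
qed

lemma right_orth_Defl:
  assumes "(\<T>, \<F>) \<in> s_torsion_pairs \<C>"
  shows "right_orth \<C> (Defl \<C> \<T>) = Defl \<C> \<F>"
proof (intro equalityI subsetI)
  fix f assume "f \<in> Defl \<C> \<F>"
  then show "f \<in> right_orth \<C> (Defl \<C> \<T>)"
    using assms by (auto simp: s_torsion_pairs_iff right_orth_def Defl_def orth_iff)
next
  fix f assume "f \<in> right_orth \<C> (Defl \<C> \<T>)"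
  then have f: "f \<in> deflations \<C>" and
    o: "\<And>g. g \<in> Defl \<C> \<T> \<Longrightarrow> hom_orth (cocone \<C> g) (cocone \<C> f)"
    by (auto simp: right_orth_def orth_iff)
  have A: "cocone \<C> f \<in> obj \<C>" using f by (rule cocone_obj)
  then obtain T F u v \<delta> where T: "T \<in> \<T>" and F: "F \<in> \<F>"
      and E: "E_triangle \<C> T u (cocone \<C> f) v F \<delta>"
    using assms by (auto simp: s_torsion_pairs_iff)
  have "T \<in> Cocone \<C> (Defl \<C> \<T>)" using T assms Cocone_Defl by (simp add: s_torsion_pairs_iff)
  then obtain g where "g \<in> Defl \<C> \<T>" "isomorphic \<C> T (cocone \<C> g)" by (auto simp: Cocone_def)
  then have "hom_orth T (cocone \<C> f)"
    using o hom_orth_iso isomorphic_sym isomorphic_refl[OF A] by blast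
  then have "isomorphic \<C> F (cocone \<C> f)"
    using torsion_free_part_iso[OF E] assms T F by (auto simp: s_torsion_pairs_iff)
  then show "f \<in> Defl \<C> \<F>"
    using assms F f by (auto simp: s_torsion_pairs_iff subcategory_def Defl_def)
qed

lemma Defl_factorization:
  assumes tp: "(\<T>, \<F>) \<in> s_torsion_pairs \<C>"
    and f: "f \<in> deflations \<C>" "B \<in> obj \<C>" "C \<in> obj \<C>" "f \<in> carrier (Hom \<C> B C)"
  shows "\<exists>X \<in> obj \<C>. \<exists>l \<in> Defl \<C> \<T> \<inter> carrier (Hom \<C> B X).
    \<exists>r \<in> Defl \<C> \<F> \<inter> carrier (Hom \<C> X C). f = r \<cdot> l"
proof -
  obtain x \<delta> where E: "E_triangle \<C> (cocone \<C> f) x B f C \<delta>"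
    using deflation_triangle[OF f] by blast
  have "cocone \<C> f \<in> obj \<C>" using f(1) by (rule cocone_obj)
  then obtain T F u v \<epsilon> where T: "T \<in> \<T>" and F: "F \<in> \<F>"
      and E': "E_triangle \<C> T u (cocone \<C> f) v F \<epsilon>"
    using tp by (auto simp: s_torsion_pairs_iff)
  \<comment> \<open>(ET4) for the inflations \<open>u\<close> and \<open>x\<close>: the deflation
    \<open>l\<close> belonging to their composite has cocone \<open>T\<close>, and the induced
    deflation \<open>r\<close> has as cocone the cone \<open>F\<close> of \<open>u\<close>.\<close>
  obtain X l d r \<delta>'' where 1: "E_triangle \<C> T (x \<cdot> u) B l X \<delta>''"
      and 2: "E_triangle \<C> F d X r C (push \<C> C v \<delta>)" and 3: "r \<cdot> l = f"
    using ET4[OF E' E] by blast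
  have "l \<in> Defl \<C> \<T>"
    using cocone_iso[OF 1] T tp by (auto simp: Defl_def s_torsion_pairs_iff subcategory_def)
  moreover have "r \<in> Defl \<C> \<F>"
    using cocone_iso[OF 2] F tp by (auto simp: Defl_def s_torsion_pairs_iff subcategory_def)
  ultimately show ?thesis using E_triangleD[OF 1] E_triangleD[OF 2] 3 by blast
qed

lemma Defl_factorization_system:
  assumes tp: "(\<T>, \<F>) \<in> s_torsion_pairs \<C>"
  shows "(Defl \<C> \<T>, Defl \<C> \<F>) \<in> deflation_factorization_systems \<C>"
  unfolding deflation_factorization_systems_def
  using Defl_factorization[OF tp] left_orth_Defl[OF tp] right_orth_Defl[OF tp]
  by (auto simp: Defl_def)

section \<open>From deflation factorization systems to s-torsion pairs\<close>

lemma factorization_system_orth: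
  assumes "(\<L>, \<R>) \<in> deflation_factorization_systems \<C>"
  shows "\<L> \<subseteq> deflations \<C>" "\<R> \<subseteq> deflations \<C>"
    and "f \<in> \<L> \<longleftrightarrow> f \<in> deflations \<C> \<and> (\<forall>g \<in> \<R>. hom_orth (cocone \<C> f) (cocone \<C> g))"
    and "g \<in> \<R> \<longleftrightarrow> g \<in> deflations \<C> \<and> (\<forall>f \<in> \<L>. hom_orth (cocone \<C> f) (cocone \<C> g))"
proof -
  have "\<L> \<subseteq> deflations \<C>" "\<R> \<subseteq> deflations \<C>" "\<L> = left_orth \<C> \<R>" "\<R> = right_orth \<C> \<L>"
    using assms by (auto simp: deflation_factorization_systems_def)
  then show "\<L> \<subseteq> deflations \<C>" "\<R> \<subseteq> deflations \<C>"
    "f \<in> \<L> \<longleftrightarrow> f \<in> deflations \<C> \<and> (\<forall>g \<in> \<R>. hom_orth (cocone \<C> f) (cocone \<C> g))"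
    "g \<in> \<R> \<longleftrightarrow> g \<in> deflations \<C> \<and> (\<forall>f \<in> \<L>. hom_orth (cocone \<C> f) (cocone \<C> g))"
    unfolding left_orth_def right_orth_def orth_iff by blast+
qed

lemma Cocone_torsion_pair:
  assumes fs: "(\<L>, \<R>) \<in> deflation_factorization_systems \<C>"
  shows "(Cocone \<C> \<L>, Cocone \<C> \<R>) \<in> s_torsion_pairs \<C>"
  unfolding s_torsion_pairs_iff
proof (intro conjI ballI subcategory_Cocone)
  note LR = factorization_system_orth[OF fs]
  fix T F assume "T \<in> Cocone \<C> \<L>" "F \<in> Cocone \<C> \<R>"
  then obtain l r where l: "l \<in> \<L>" "isomorphic \<C> T (cocone \<C> l)"
      and r: "r \<in> \<R>" "isomorphic \<C> F (cocone \<C> r)"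
    unfolding Cocone_def by blast
  have "hom_orth (cocone \<C> l) (cocone \<C> r)" using LR(3) l(1) r(1) by blast
  then show "hom_orth T F"
    by (rule hom_orth_iso[OF _ isomorphic_sym[OF l(2)] isomorphic_sym[OF r(2)]])
next
  note LR = factorization_system_orth[OF fs]
  fix X assume X: "X \<in> obj \<C>"
  obtain Z y where Z: "Z \<in> obj \<C>" "idm \<C> Z = \<one>\<^bsub>Hom \<C> Z Z\<^esub>"
      and y: "y \<in> carrier (Hom \<C> X Z)" "y \<in> deflations \<C>"
    using to_zero_deflation[OF X] by blast
  obtain Y l r where Y: "Y \<in> obj \<C>" and l: "l \<in> \<L>" "l \<in> carrier (Hom \<C> X Y)"
      and r: "r \<in> \<R>" "r \<in> carrier (Hom \<C> Y Z)"
    using fs X Z(1) y unfolding deflation_factorization_systems_def by blast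
  have d: "l \<in> deflations \<C>" "r \<in> deflations \<C>" using LR(1,2) l r by blast+
  obtain x \<delta> where E: "E_triangle \<C> (cocone \<C> l) x X l Y \<delta>"
    using deflation_triangle[OF d(1) X Y l(2)] by blast
  obtain x' \<delta>' where "E_triangle \<C> (cocone \<C> r) x' Y r Z \<delta>'"
    using deflation_triangle[OF d(2) Y Z(1) r(2)] by blast
  \<comment> \<open>The triangle of \<open>r\<close> ends in a zero object, so the middle object
    \<open>Y\<close> of the factorization is itself a cocone of \<open>r\<close>; the triangle of
    \<open>l\<close> is therefore the torsion triangle of \<open>X\<close>.\<close>
  then have "isomorphic \<C> Y (cocone \<C> r)"
    using E_triangle_zero_right Z(2) isomorphic_sym by blast
  then have "Y \<in> Cocone \<C> \<R>" using r(1) Y by (auto simp: Cocone_def)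
  then show "\<exists>T \<in> Cocone \<C> \<L>. \<exists>F \<in> Cocone \<C> \<R>. \<exists>f g \<delta>. E_triangle \<C> T f X g F \<delta>"
    using E cocone_in_Cocone[OF l(1) d(1)] by blast
qed

text \<open>Membership in either class depends on the cocone alone. If the cocone of a deflation
  lies in \<open>Cocone \<C> \<L>\<close>, it is orthogonal to the cocones of all members of
  \<open>\<R>\<close>, and the condition that \<open>\<L>\<close> is the left orthogonal of
  \<open>\<R>\<close> returns the deflation to \<open>\<L>\<close>; symmetrically for
  \<open>\<R>\<close>.\<close>

lemma Defl_Cocone:
  assumes fs: "(\<L>, \<R>) \<in> deflation_factorization_systems \<C>"
  shows "Defl \<C> (Cocone \<C> \<L>) = \<L>" "Defl \<C> (Cocone \<C> \<R>) = \<R>"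
proof -
  note LR = factorization_system_orth[OF fs]
  have tp: "(Cocone \<C> \<L>, Cocone \<C> \<R>) \<in> s_torsion_pairs \<C>" using fs by (rule Cocone_torsion_pair)
  have in_L: "cocone \<C> f \<in> Cocone \<C> \<L>" if "f \<in> \<L>" for f
    using that LR(1) cocone_in_Cocone by blast
  have in_R: "cocone \<C> f \<in> Cocone \<C> \<R>" if "f \<in> \<R>" for f
    using that LR(2) cocone_in_Cocone by blast
  have orth: "hom_orth T F" if "T \<in> Cocone \<C> \<L>" "F \<in> Cocone \<C> \<R>" for T F
    using tp that by (auto simp: s_torsion_pairs_iff)
  show "Defl \<C> (Cocone \<C> \<L>) = \<L>"
    using in_L in_R orth LR(1,3) by (auto simp: Defl_def)
  show "Defl \<C> (Cocone \<C> \<R>) = \<R>"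
    using in_L in_R orth LR(2,4) by (auto simp: Defl_def)
qed

end

section \<open>The two assignments as mutually inverse bijections\<close>

theorem theorem3p2:
  fixes \<C> :: "('o, 'm, 'e, 'n, 'z) neg_ext_cat_scheme"
  assumes "neg_extriangulated_category \<C>"
  shows "bij_betw (\<lambda>(\<T>, \<F>). (Defl \<C> \<T>, Defl \<C> \<F>))
           (s_torsion_pairs \<C>) (deflation_factorization_systems \<C>) \<and>
         bij_betw (\<lambda>(\<L>, \<R>). (Cocone \<C> \<L>, Cocone \<C> \<R>))
           (deflation_factorization_systems \<C>) (s_torsion_pairs \<C>) \<and>
         (\<forall>(\<T>, \<F>) \<in> s_torsion_pairs \<C>.
            (Cocone \<C> (Defl \<C> \<T>), Cocone \<C> (Defl \<C> \<F>)) = (\<T>, \<F>)) \<and>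
         (\<forall>(\<L>, \<R>) \<in> deflation_factorization_systems \<C>.
            (Defl \<C> (Cocone \<C> \<L>), Defl \<C> (Cocone \<C> \<R>)) = (\<L>, \<R>))"
proof -
  interpret neg_extriangulated_category \<C> by (rule assms)
  let ?D = "\<lambda>(\<T>, \<F>). (Defl \<C> \<T>, Defl \<C> \<F>)" and ?K = "\<lambda>(\<L>, \<R>). (Cocone \<C> \<L>, Cocone \<C> \<R>)"
  have KD: "\<forall>p \<in> s_torsion_pairs \<C>. ?K (?D p) = p"
    by (auto simp: s_torsion_pairs_iff Cocone_Defl)
  have DK: "\<forall>p \<in> deflation_factorization_systems \<C>. ?D (?K p) = p"
    by (auto simp: Defl_Cocone)
  have D: "?D ` s_torsion_pairs \<C> \<subseteq> deflation_factorization_systems \<C>"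
    using Defl_factorization_system by auto
  have K: "?K ` deflation_factorization_systems \<C> \<subseteq> s_torsion_pairs \<C>"
    using Cocone_torsion_pair by auto
  show ?thesis
    using bij_betw_byWitness[OF KD DK D K] bij_betw_byWitness[OF DK KD K D] KD DK by auto
qed

end
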